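(* Let $m\ge2$, let $\Sigma$ be a positive-definite $m\times m$ matrix with $\Sigma_{jj}=1$ for all $j$, let $W\sim N_m(\mu,\Sigma)$ with null set $\mathcal H_0=\{j:\mu_j=0\}$, and let $X\sim N_m(0,\Sigma)$. Let $L_\Sigma(X)$, $\Omega_\Sigma^-(X)$ and $M_\Sigma^-=\mathbb E\{\Omega_\Sigma^-(X)\}$ be as defined in the context. Let $0\le\delta<1$ and let $\kappa_{\Sigma,\delta}\ge0$ satisfy $$\mathbb P\{L_\Sigma(X)>\kappa_{\Sigma,\delta}\}\le\delta.$$ Then, for every mean vector $\mu$ and every $q\in(0,1)$, the FDR of the knockoff+ threshold run on $W$ at level $q$ satisfies $$\mathrm{FDR}(q)\le\min\left\{e^{\kappa_{\Sigma,\delta}}q+\delta,\;M_\Sigma^-q\right\}.$$ Moreover, $1\le M_\Sigma^-\le1+m/2$. The distributions of $L_\Sigma(X)$ and $\Omega_\Sigma^-(X)$ depend only on $\Sigma$ (the unknown null set and nonnull means do not enter).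
   Context: For $t>0$, put $N_+(t)=\#\{i:W_i\ge t\}$, $N_-(t)=\#\{i:W_i\le -t\}$, $\mathcal T=\{|W_i|:|W_i|>0\}$. The knockoff+ threshold at level $q$ is $\widehat t=\min\{t\in\mathcal T:(1+N_-(t))/\max(N_+(t),1)\le q\}$, with $\widehat t=\infty$ if the set is empty; the rejection set is $\widehat{\mathcal R}=\{i:W_i\ge\widehat t\}$, and $\mathrm{FDR}=\mathbb E\{|\widehat{\mathcal R}\cap\mathcal H_0|/\max(|\widehat{\mathcal R}|,1)\}$. A subscript $-j$ means that coordinate $j$ (or the corresponding row or column) is removed. For $j=1,\ldots,m$, put $b_j=\Sigma_{-j,-j}^{-1}\Sigma_{-j,j}$ and $\tau_j^2=1-\Sigma_{j,-j}b_j$. Define $$\ell_j(X)=\frac{2|X_j|\,b_j^{\mathsf T}X_{-j}}{\tau_j^2},\qquad L_\Sigma(X)=\max_{1\le j\le m}\max\{\ell_j(X),0\},$$ $$\Omega_\Sigma^-(X)=\exp\Big[\max\Big\{0,\max_{1\le j\le m,\;X_j<0}\ell_j(X)\Big\}\Big],\qquad M_\Sigma^-=\mathbb E\{\Omega_\Sigma^-(X)\},$$ where the inner maximum is $-\infty$ if no coordinate of $X$ is negative. *)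

theory Defs
  imports "HOL-Probability.Probability"
begin

definition positive_definite :: "real^'m^'m \<Rightarrow> bool" where
  "positive_definite S \<longleftrightarrow> transpose S = S \<and> (\<forall>x. x \<noteq> 0 \<longrightarrow> x \<bullet> (S *v x) > 0)"

text \<open>Lebesgue density of the nondegenerate normal law; only meaningful for positive definite \<open>S\<close>.\<close>

definition mvn_density :: "real^'m \<Rightarrow> real^'m^'m \<Rightarrow> real^'m \<Rightarrow> real" where
  "mvn_density \<mu> S x =
     exp (- ((x - \<mu>) \<bullet> (matrix_inv S *v (x - \<mu>))) / 2) / sqrt ((2 * pi) ^ CARD('m) * det S)"

definition mvn_distributed :: "'a measure \<Rightarrow> ('a \<Rightarrow> real^'m) \<Rightarrow> real^'m \<Rightarrow> real^'m^'m \<Rightarrow> bool" where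
  "mvn_distributed M X \<mu> S \<longleftrightarrow> distributed M lborel X (\<lambda>x. ennreal (mvn_density \<mu> S x))"

definition mvn :: "real^'m \<Rightarrow> real^'m^'m \<Rightarrow> (real^'m) measure" where
  "mvn \<mu> S = density lborel (\<lambda>x. ennreal (mvn_density \<mu> S x))"

definition N_plus :: "real^'m \<Rightarrow> real \<Rightarrow> nat" where
  "N_plus w t = card {i. w $ i \<ge> t}"

definition N_minus :: "real^'m \<Rightarrow> real \<Rightarrow> nat" where
  "N_minus w t = card {i. w $ i \<le> - t}"

definition candidates :: "real^'m \<Rightarrow> real set" where
  "candidates w = {\<bar>w $ i\<bar> | i. \<bar>w $ i\<bar> > 0}"

definition knockoff_plus_feasible :: "real \<Rightarrow> real^'m \<Rightarrow> real set" where
  "knockoff_plus_feasible q w =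
     {t \<in> candidates w. (1 + real (N_minus w t)) / real (max (N_plus w t) 1) \<le> q}"

definition knockoff_plus_threshold :: "real \<Rightarrow> real^'m \<Rightarrow> ereal" where
  "knockoff_plus_threshold q w =
     (if knockoff_plus_feasible q w = {} then \<infinity> else ereal (Min (knockoff_plus_feasible q w)))"

definition rejections :: "real \<Rightarrow> real^'m \<Rightarrow> 'm set" where
  "rejections q w = {i. ereal (w $ i) \<ge> knockoff_plus_threshold q w}"

definition null_set :: "real^'m \<Rightarrow> 'm set" where
  "null_set \<mu> = {j. \<mu> $ j = 0}"

definition FDR :: "'a measure \<Rightarrow> ('a \<Rightarrow> real^'m) \<Rightarrow> 'm set \<Rightarrow> real \<Rightarrow> real" where
  "FDR M W H0 q =
     (\<integral>\<omega>. real (card (rejections q (W \<omega>) \<inter> H0)) / real (max (card (rejections q (W \<omega>))) 1) \<partial>M)"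

text \<open>
  The inverse of the principal submatrix of \<open>S\<close> with rows and columns in \<open>I\<close>, following the
  definition of \<open>matrix_inv\<close> but with all indices restricted to \<open>I\<close>. Entries outside
  \<open>I \<times> I\<close> are unspecified and never used.
\<close>

definition principal_inv :: "'m set \<Rightarrow> real^'m^'m \<Rightarrow> 'm \<Rightarrow> 'm \<Rightarrow> real" where
  "principal_inv I S = (SOME B. \<forall>k\<in>I. \<forall>l\<in>I.
     (\<Sum>i\<in>I. S $ k $ i * B i l) = (if k = l then 1 else 0) \<and>
     (\<Sum>i\<in>I. B k i * S $ i $ l) = (if k = l then 1 else 0))"

text \<open>
  \<open>reg_coef S j\<close> is the vector \<open>b\<^sub>j\<close> with coordinates \<open>k \<noteq> j\<close>; its value at \<open>k = j\<close> is never used.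
  The set \<open>- {j}\<close> is the complement of \<open>{j}\<close>.
\<close>

definition reg_coef :: "real^'m^'m \<Rightarrow> 'm \<Rightarrow> 'm \<Rightarrow> real" where
  "reg_coef S j k = (\<Sum>l\<in>- {j}. principal_inv (- {j}) S k l * S $ l $ j)"

definition tau_sq :: "real^'m^'m \<Rightarrow> 'm \<Rightarrow> real" where
  "tau_sq S j = 1 - (\<Sum>k\<in>- {j}. S $ j $ k * reg_coef S j k)"

definition ell :: "real^'m^'m \<Rightarrow> 'm \<Rightarrow> real^'m \<Rightarrow> real" where
  "ell S j x = 2 * \<bar>x $ j\<bar> * (\<Sum>k\<in>- {j}. reg_coef S j k * x $ k) / tau_sq S j"

definition L_stat :: "real^'m^'m \<Rightarrow> real^'m \<Rightarrow> real" where
  "L_stat S x = (MAX j. max (ell S j x) 0)"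

text \<open>Inserting \<open>0\<close> into the set makes the maximum \<open>0\<close> when no coordinate is negative.\<close>

definition Omega_minus :: "real^'m^'m \<Rightarrow> real^'m \<Rightarrow> real" where
  "Omega_minus S x = exp (Max (insert 0 {ell S j x | j. x $ j < 0}))"

text \<open>
  Both statistics are Borel functions, so the probabilities, expectations and image measures
  formed from them do not take default values for nonmeasurable functions.
\<close>

lemma ell_measurable [measurable]: "ell S j \<in> borel_measurable borel"
  unfolding ell_def by measurable

lemma L_stat_measurable [measurable]: "L_stat S \<in> borel_measurable borel"
  unfolding L_stat_def by (intro borel_measurable_Max) auto

lemma Omega_minus_measurable [measurable]: "Omega_minus S \<in> borel_measurable borel"
proof -
  have "Omega_minus S x = exp (MAX j. if x $ j < 0 then max 0 (ell S j x) else 0)" for x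
  proof -
    have "Max (insert 0 {ell S j x | j. x $ j < 0}) = (MAX j. if x $ j < 0 then max 0 (ell S j x) else 0)"
      (is "Max ?A = Max ?B")
    proof (rule antisym)
      have fin: "finite ?A" by (simp add: setcompr_eq_image)
      have ub: "(if x $ j < 0 then max 0 (ell S j x) else 0) \<le> Max ?B" for j
        by (rule Max_ge) auto
      have "a \<le> Max ?B" if "a \<in> ?A" for a
      proof (cases "a = 0")
        case True
        have "0 \<le> (if x $ j < 0 then max 0 (ell S j x) else 0)" for j by simp
        with ub True show ?thesis by (meson order_trans)
      next
        case False
        with that obtain j where "a = ell S j x" "x $ j < 0" by auto
        with ub[of j] show ?thesis by simp
      qed
      with fin show "Max ?A \<le> Max ?B" by simp
      have z: "0 \<le> Max ?A" using fin by auto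
      have e: "ell S j x \<le> Max ?A" if "x $ j < 0" for j
        by (rule Max_ge[OF fin]) (use that in blast)
      show "Max ?B \<le> Max ?A"
      proof (rule Max.boundedI)
        fix b assume "b \<in> ?B"
        then show "b \<le> Max ?A" using z e by (auto split: if_splits)
      qed (rule finite_imageI, simp, blast)
    qed
    then show ?thesis by (simp add: Omega_minus_def)
  qed
  then have eq: "Omega_minus S = (\<lambda>x. exp (MAX j. if x $ j < 0 then max 0 (ell S j x) else 0))"
    by auto
  have "(\<lambda>x::real^'a. MAX j. if x $ j < 0 then max 0 (ell S j x) else 0) \<in> borel_measurable borel"
    by (intro borel_measurable_Max) auto
  then show ?thesis unfolding eq by measurable
qed

end

theory Submission
  imports Defs
begin

text \<open>
  Let \<open>X = W - \<mu>\<close>. For a null coordinate \<open>j\<close> the density of \<open>X\<close> changes by the factor \<open>exp (ell S j x)\<close>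
  when \<open>x $ j < 0\<close> is reflected, because \<open>b\<^sub>j / \<tau>\<^sub>j\<^sup>2\<close> is minus the \<open>j\<close>-th off-diagonal row of the
  inverse of \<open>S\<close>. At the knockoff+ threshold the false discovery proportion is at most \<open>q\<close> times the
  sum over null \<open>j\<close> of \<open>1{j selected} / (1 + N_minus)\<close>. Reflecting each summand turns it into the
  same weight, evaluated with \<open>w $ j\<close> replaced by its absolute value, on the event \<open>w $ j < 0\<close>, times
  \<open>exp (ell S j x)\<close>. All negative coordinates that would be selected after such a replacement share
  one threshold, so the reflected weights sum to at most \<open>1\<close>, and only the largest exponential
  factor matters.
\<close>

section \<open>Linear algebra: the inverse of \<open>S\<close>, the regression coefficients and
  \<open>ell\<close>\<close>

lemma sum_complement:
  fixes f :: "'m::finite \<Rightarrow> real"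
  shows "(\<Sum>k\<in>- {j}. f k) = (\<Sum>k\<in>UNIV. f k) - f j"
  by (simp add: Compl_eq_Diff_UNIV sum_diff1)

lemma positive_definite_invertible:
  fixes S :: "real^'m^'m"
  assumes "positive_definite S"
  shows "invertible S"
proof -
  have "x = 0" if "S *v x = 0" for x
    using assms that unfolding positive_definite_def by force
  then show ?thesis
    by (simp add: invertible_left_inverse matrix_left_invertible_ker)
qed

lemma positive_definite_inverse:
  fixes S :: "real^'m^'m"
  assumes "positive_definite S"
  shows "S ** matrix_inv S = mat 1" "matrix_inv S ** S = mat 1"
  using someI_ex[of "\<lambda>A. S ** A = mat 1 \<and> A ** S = mat 1"] positive_definite_invertible[OF assms]
  unfolding invertible_def matrix_inv_def by blast+

lemma transpose_matrix_inv_positive_definite: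
  fixes S :: "real^'m^'m"
  assumes "positive_definite S"
  shows "transpose (matrix_inv S) = matrix_inv S"
proof -
  have "transpose (matrix_inv S) ** S = mat 1"
    using arg_cong[OF positive_definite_inverse(1)[OF assms], of transpose] assms
    by (simp add: matrix_transpose_mul positive_definite_def)
  then have "transpose (matrix_inv S) ** S ** matrix_inv S = matrix_inv S"
    by simp
  then show ?thesis
    using positive_definite_inverse[OF assms] by (simp add: matrix_mul_assoc[symmetric])
qed

text \<open>With \<open>y\<close> the \<open>j\<close>-th column of the inverse,
  \<open>S *v y\<close> is a unit vector, so the quadratic form of \<open>S\<close> at
  \<open>y\<close> is the diagonal entry itself.\<close>

lemma matrix_inv_diag_pos:
  fixes S :: "real^'m^'m"
  assumes "positive_definite S"
  shows "matrix_inv S $ j $ j > 0"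
proof -
  define y where "y = matrix_inv S *v axis j 1"
  have Sy: "S *v y = axis j 1"
    using positive_definite_inverse(1)[OF assms]
    by (simp add: y_def matrix_vector_mul_assoc)
  then have "y \<noteq> 0" by (metis axis_eq_0_iff matrix_vector_mult_0_right zero_neq_one)
  then have "y \<bullet> (S *v y) > 0" using assms by (simp add: positive_definite_def)
  then have "y $ j > 0" by (simp add: Sy inner_axis)
  then show ?thesis by (simp add: y_def matrix_vector_mul_component inner_axis)
qed

text \<open>\<open>principal_inv\<close> is a \<open>SOME\<close> term, so its defining property is
  available only after an explicit two-sided inverse has been exhibited.\<close>

lemma principal_inv_inverse:
  fixes S :: "real^'m^'m"
  assumes pd: "positive_definite S" and kl: "k \<in> - {j}" "l \<in> - {j}"
  shows "(\<Sum>i\<in>- {j}. principal_inv (- {j}) S k i * S $ i $ l) = (if k = l then 1 else 0)"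
proof -
  define A where "A = matrix_inv S"
  have Ajj: "A $ j $ j \<noteq> 0" using matrix_inv_diag_pos[OF pd, of j] by (simp add: A_def)
  have SA: "(\<Sum>i\<in>UNIV. S $ k $ i * A $ i $ l) = (if k = l then 1 else 0)" for k l
    using arg_cong[OF positive_definite_inverse(1)[OF pd], of "\<lambda>M. M $ k $ l"]
    by (simp add: matrix_matrix_mult_def mat_def A_def)
  have AS: "(\<Sum>i\<in>UNIV. A $ k $ i * S $ i $ l) = (if k = l then 1 else 0)" for k l
    using arg_cong[OF positive_definite_inverse(2)[OF pd], of "\<lambda>M. M $ k $ l"]
    by (simp add: matrix_matrix_mult_def mat_def A_def)
  \<comment> \<open>The Schur complement of the entry \<open>A $ j $ j\<close> in \<open>A\<close>.
    It vanishes for \<open>k = j\<close> and for \<open>l = j\<close>, so sums over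
    \<open>- {j}\<close> extend to all indices, where \<open>S\<close> and \<open>A\<close>
    cancel.\<close>
  define B where "B k l = A $ k $ l - A $ k $ j * A $ j $ l / A $ j $ j" for k l
  have "(\<Sum>i\<in>- {j}. S $ k $ i * B i l) = (if k = l then 1 else 0)"
    if "k \<noteq> j" "l \<noteq> j" for k l
  proof -
    have "(\<Sum>i\<in>- {j}. S $ k $ i * B i l)
       = (\<Sum>i\<in>UNIV. S $ k $ i * A $ i $ l) - (\<Sum>i\<in>UNIV. S $ k $ i * A $ i $ j) * (A $ j $ l / A $ j $ j)"
      unfolding sum_complement
      by (simp add: B_def Ajj right_diff_distrib sum_subtractf sum_distrib_right sum_divide_distrib mult.assoc)
    then show ?thesis using that by (simp add: SA)
  qed
  moreover have "(\<Sum>i\<in>- {j}. B k i * S $ i $ l) = (if k = l then 1 else 0)"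
    if "k \<noteq> j" "l \<noteq> j" for k l
  proof -
    have "(\<Sum>i\<in>- {j}. B k i * S $ i $ l)
       = (\<Sum>i\<in>UNIV. A $ k $ i * S $ i $ l) - A $ k $ j / A $ j $ j * (\<Sum>i\<in>UNIV. A $ j $ i * S $ i $ l)"
      unfolding sum_complement
      by (simp add: B_def Ajj left_diff_distrib sum_subtractf sum_distrib_left sum_divide_distrib mult.assoc)
    then show ?thesis using that by (simp add: AS)
  qed
  ultimately have "\<forall>k\<in>- {j}. \<forall>l\<in>- {j}.
     (\<Sum>i\<in>- {j}. S $ k $ i * B i l) = (if k = l then 1 else 0) \<and>
     (\<Sum>i\<in>- {j}. B k i * S $ i $ l) = (if k = l then 1 else 0)"
    by simp
  from someI[of "\<lambda>B. \<forall>k\<in>- {j}. \<forall>l\<in>- {j}.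
     (\<Sum>i\<in>- {j}. S $ k $ i * B i l) = (if k = l then 1 else 0) \<and>
     (\<Sum>i\<in>- {j}. B k i * S $ i $ l) = (if k = l then 1 else 0)", OF this] kl
  show ?thesis unfolding principal_inv_def[symmetric] by blast
qed

text \<open>Column \<open>j\<close> of \<open>S ** matrix_inv S = mat 1\<close>, divided by
  \<open>- matrix_inv S $ j $ j\<close>, gives the normal equations for \<open>c\<close> in its rows
  \<open>l \<noteq> j\<close> and the residual variance in row \<open>j\<close>.\<close>

lemma
  fixes S :: "real^'m^'m"
  assumes pd: "positive_definite S"
  shows reg_coef_eq: "k \<noteq> j \<Longrightarrow> reg_coef S j k = - matrix_inv S $ k $ j / matrix_inv S $ j $ j"
    and tau_sq_eq: "S $ j $ j = 1 \<Longrightarrow> tau_sq S j = 1 / matrix_inv S $ j $ j"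
proof -
  define A where "A = matrix_inv S"
  have Ajj: "A $ j $ j \<noteq> 0" using matrix_inv_diag_pos[OF pd, of j] by (simp add: A_def)
  have SA: "(\<Sum>i\<in>UNIV. S $ k $ i * A $ i $ l) = (if k = l then 1 else 0)" for k l
    using arg_cong[OF positive_definite_inverse(1)[OF pd], of "\<lambda>M. M $ k $ l"]
    by (simp add: matrix_matrix_mult_def mat_def A_def)
  define c where "c i = - A $ i $ j / A $ j $ j" for i
  have Sc: "(\<Sum>i\<in>- {j}. S $ l $ i * c i) = S $ l $ j - (if l = j then 1 / A $ j $ j else 0)" for l
  proof -
    have "(\<Sum>i\<in>UNIV. S $ l $ i * c i) = - (\<Sum>i\<in>UNIV. S $ l $ i * A $ i $ j) / A $ j $ j"
      by (simp add: c_def sum_negf sum_divide_distrib)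
    then show ?thesis
      unfolding sum_complement by (simp add: SA) (simp add: c_def Ajj)
  qed
  have reg: "reg_coef S j k = c k" if "k \<noteq> j" for k
  proof -
    \<comment> \<open>The normal equations replace \<open>S $ l $ j\<close>, after which the left
      inverse cancels the principal submatrix.\<close>
    have "reg_coef S j k = (\<Sum>l\<in>- {j}. principal_inv (- {j}) S k l * (\<Sum>i\<in>- {j}. S $ l $ i * c i))"
      unfolding reg_coef_def by (rule sum.cong) (auto simp: Sc)
    also have "\<dots> = (\<Sum>i\<in>- {j}. (\<Sum>l\<in>- {j}. principal_inv (- {j}) S k l * S $ l $ i) * c i)"
      unfolding sum_distrib_left sum_distrib_right
      by (subst sum.swap) (simp add: mult.assoc)
    also have "\<dots> = (\<Sum>i\<in>- {j}. if k = i then c i else 0)"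
      using that by (intro sum.cong) (auto simp: principal_inv_inverse[OF pd])
    also have "\<dots> = c k" using that by simp
    finally show ?thesis .
  qed
  then show "k \<noteq> j \<Longrightarrow> reg_coef S j k = - matrix_inv S $ k $ j / matrix_inv S $ j $ j"
    by (simp add: c_def A_def)
  have "(\<Sum>k\<in>- {j}. S $ j $ k * reg_coef S j k) = (\<Sum>k\<in>- {j}. S $ j $ k * c k)"
    by (rule sum.cong) (auto simp: reg)
  then show "S $ j $ j = 1 \<Longrightarrow> tau_sq S j = 1 / matrix_inv S $ j $ j"
    by (simp add: tau_sq_def Sc A_def)
qed

lemma ell_eq:
  fixes S :: "real^'m^'m"
  assumes pd: "positive_definite S" and "S $ j $ j = 1"
  shows "ell S j x = - 2 * \<bar>x $ j\<bar> * (\<Sum>k\<in>- {j}. matrix_inv S $ j $ k * x $ k)"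
proof -
  have sym: "matrix_inv S $ k $ j = matrix_inv S $ j $ k" for k
    using arg_cong[OF transpose_matrix_inv_positive_definite[OF pd], of "\<lambda>M. M $ j $ k"]
    by (simp add: transpose_def)
  have "(\<Sum>k\<in>- {j}. reg_coef S j k * x $ k)
      = - (\<Sum>k\<in>- {j}. matrix_inv S $ j $ k * x $ k) / matrix_inv S $ j $ j"
    unfolding sum_negf[symmetric] sum_divide_distrib
  proof (rule sum.cong)
    fix k assume "k \<in> - {j}"
    then show "reg_coef S j k * x $ k = - (matrix_inv S $ j $ k * x $ k) / matrix_inv S $ j $ j"
      unfolding sym[of k, symmetric] by (simp add: reg_coef_eq[OF pd])
  qed simp
  then show ?thesis
    using matrix_inv_diag_pos[OF pd, of j] by (simp add: ell_def tau_sq_eq[OF assms])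
qed

section \<open>Reflection of one coordinate and its effect on the normal density\<close>

definition reflect :: "'m \<Rightarrow> real^'m \<Rightarrow> real^'m" where
  "reflect j x = (\<chi> i. if i = j then - x $ i else x $ i)"

lemma reflect_nth: "reflect j x $ i = (if i = j then - x $ i else x $ i)"
  by (simp add: reflect_def)

lemma ell_reflect: "ell S j (reflect j x) = ell S j x"
proof -
  have "(\<Sum>k\<in>- {j}. reg_coef S j k * reflect j x $ k) = (\<Sum>k\<in>- {j}. reg_coef S j k * x $ k)"
    by (rule sum.cong) (auto simp: reflect_nth)
  then show ?thesis by (simp add: ell_def reflect_nth)
qed

text \<open>Flipping the sign of \<open>x $ j\<close> leaves the squared terms of the quadratic form
  alone and reverses only the cross terms containing \<open>x $ j\<close>. For
  \<open>x $ j < 0\<close> the change equals \<open>- 2 * ell S j x\<close>.\<close>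

lemma mvn_density_reflect:
  fixes S :: "real^'m^'m"
  assumes pd: "positive_definite S" and "S $ j $ j = 1" and neg: "x $ j < 0"
  shows "mvn_density 0 S (reflect j x) = mvn_density 0 S x * exp (ell S j x)"
proof -
  define A where "A = matrix_inv S"
  have sym: "transpose A = A"
    using transpose_matrix_inv_positive_definite[OF pd] by (simp add: A_def)
  define e :: "real^'m" where "e = axis j 1"
  have r: "reflect j x = x - (2 * x $ j) *\<^sub>R e"
    by (auto simp: vec_eq_iff reflect_nth e_def axis_def)
  have Ax: "(A *v x) $ j = A $ j $ j * x $ j + (\<Sum>k\<in>- {j}. A $ j $ k * x $ k)"
    unfolding sum_complement by (simp add: matrix_vector_mult_def)
  have eAx: "e \<bullet> (A *v x) = (A *v x) $ j"
    by (simp add: e_def inner_axis')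
  have xAe: "x \<bullet> (A *v e) = (A *v x) $ j"
    using sym eAx by (metis dot_lmul_matrix inner_commute transpose_matrix_vector)
  have eAe: "e \<bullet> (A *v e) = A $ j $ j"
    by (simp add: e_def inner_axis' matrix_vector_mul_component inner_axis)
  have "reflect j x \<bullet> (A *v reflect j x)
      = x \<bullet> (A *v x) - 4 * x $ j * (A *v x) $ j + 4 * (x $ j)^2 * A $ j $ j"
    unfolding r
    by (simp add: matrix_vector_mult_diff_distrib matrix_vector_mult_scaleR inner_diff_left
        inner_diff_right eAx xAe eAe power2_eq_square algebra_simps)
  then have "reflect j x \<bullet> (A *v reflect j x) = x \<bullet> (A *v x) - 2 * ell S j x"
    using neg unfolding ell_eq[OF assms(1,2)] A_def[symmetric] Ax
    by (simp add: power2_eq_square algebra_simps)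
  then show ?thesis
    by (simp add: mvn_density_def A_def[symmetric] exp_add[symmetric] diff_divide_distrib)
qed

section \<open>Deterministic properties of the knockoff+ threshold\<close>

lemma finite_feasible: "finite (knockoff_plus_feasible q w)"
  by (rule finite_subset[of _ "range (\<lambda>i. \<bar>w $ i\<bar>)"])
    (auto simp: knockoff_plus_feasible_def candidates_def)

text \<open>Covers the infinite threshold as well, since then no feasible \<open>t\<close> exists.
  It replaces case distinctions on the minimum by an existential statement.\<close>

lemma threshold_le_iff:
  "knockoff_plus_threshold q w \<le> ereal y \<longleftrightarrow> (\<exists>t\<in>knockoff_plus_feasible q w. t \<le> y)"
  using finite_feasible[of q w] by (auto simp: knockoff_plus_threshold_def Min_le_iff)

text \<open>
  The cardinality is \<open>N_minus w\<close> at the threshold, and the weight is \<open>0\<close> when the threshold is infinite.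
\<close>

definition null_weight :: "real \<Rightarrow> 'm \<Rightarrow> real^'m \<Rightarrow> real" where
  "null_weight q j w = of_bool (knockoff_plus_threshold q w \<le> ereal (w $ j)) /
     (1 + real (card {k. knockoff_plus_threshold q w \<le> ereal (- w $ k)}))"

text \<open>For a null \<open>j\<close>, this vector is the same for a sample and its reflection,
  and it is the sample itself when coordinate \<open>j\<close> is positive. Weights evaluated at it
  are therefore unaffected by the reflection.\<close>

definition abs_coord :: "'m \<Rightarrow> real^'m \<Rightarrow> real^'m" where
  "abs_coord j w = (\<chi> i. if i = j then \<bar>w $ i\<bar> else w $ i)"

lemma abs_coord_nth: "abs_coord j w $ i = (if i = j then \<bar>w $ i\<bar> else w $ i)"
  by (simp add: abs_coord_def)

lemma abs_coord_eq_self: "0 < w $ j \<Longrightarrow> abs_coord j w = w"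
  by (simp add: abs_coord_def vec_eq_iff)

lemma null_weight_nonneg: "0 \<le> null_weight q j w"
  by (simp add: null_weight_def)

text \<open>Candidate thresholds are strictly positive, so such a coordinate is never
  selected.\<close>

lemma null_weight_eq_0:
  assumes "w $ j \<le> 0"
  shows "null_weight q j w = 0"
proof -
  have "\<not> (knockoff_plus_threshold q w \<le> ereal (w $ j))"
    unfolding threshold_le_iff using assms
    by (auto simp: knockoff_plus_feasible_def candidates_def)
  then show ?thesis by (simp add: null_weight_def)
qed

text \<open>The proportion factors as \<open>D / max (card R) 1\<close> times
  \<open>card (R \<inter> H) / D\<close>. The first factor is the knockoff+ ratio at an attained
  threshold, hence at most \<open>q\<close>; the second is the sum of the weights.\<close>

lemma FDP_le_sum_null_weight:
  fixes w :: "real^'m"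
  assumes "0 < q"
  shows "real (card (rejections q w \<inter> H)) / real (max (card (rejections q w)) 1)
       \<le> q * (\<Sum>j\<in>H. null_weight q j w)"
proof (cases "rejections q w = {}")
  case True
  then show ?thesis using assms by (simp add: sum_nonneg null_weight_nonneg)
next
  case False
  define F where "F = knockoff_plus_feasible q w"
  define R where "R = rejections q w"
  define D where "D = 1 + real (card {k. knockoff_plus_threshold q w \<le> ereal (- w $ k)})"
  have "F \<noteq> {}"
    using False by (auto simp: rejections_def threshold_le_iff F_def)
  define t where "t = Min F"
  have tF: "t \<in> F" using \<open>F \<noteq> {}\<close> Min_in[OF finite_feasible] by (simp add: t_def F_def)
  have thr: "knockoff_plus_threshold q w = ereal t"
    using \<open>F \<noteq> {}\<close> by (simp add: knockoff_plus_threshold_def F_def t_def)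
  have R: "card R = N_plus w t" by (simp add: R_def rejections_def thr N_plus_def)
  have D: "D = 1 + real (N_minus w t)"
    by (simp add: D_def thr N_minus_def le_minus_iff)
  have Dpos: "D > 0" by (simp add: D_def add_pos_nonneg)
  have le: "D / real (max (card R) 1) \<le> q"
    using tF unfolding R D by (simp add: F_def knockoff_plus_feasible_def)
  have "real (card (R \<inter> H)) / real (max (card R) 1)
      = (D / real (max (card R) 1)) * (real (card (R \<inter> H)) / D)"
    using Dpos by simp
  also have "\<dots> \<le> q * (real (card (R \<inter> H)) / D)"
    using le Dpos by (intro mult_right_mono) auto
  also have "real (card (R \<inter> H)) / D = (\<Sum>j\<in>H. null_weight q j w)"
  proof -
    have "real (card (R \<inter> H)) = (\<Sum>j\<in>H. of_bool (j \<in> R))"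
      by (simp add: Int_commute of_bool_def sum.If_cases)
    then show ?thesis
      by (simp only: sum_divide_distrib) (simp add: null_weight_def R_def rejections_def D_def)
  qed
  finally show ?thesis unfolding R_def .
qed

text \<open>The right-hand side does not mention \<open>j\<close>, which is why the thresholds for different \<open>j\<close> agree.\<close>

lemma feasible_abs_coord_iff:
  fixes w :: "real^'m"
  assumes "0 < s" "w $ j \<le> - s"
  shows "s \<in> knockoff_plus_feasible q (abs_coord j w) \<longleftrightarrow>
    s \<in> candidates w \<and> real (N_minus w s) / real (Suc (N_plus w s)) \<le> q"
proof -
  have c: "candidates (abs_coord j w) = candidates w"
    unfolding candidates_def abs_coord_nth
    by (intro Collect_cong ex_cong1) auto
  have "{i. abs_coord j w $ i \<ge> s} = insert j {i. w $ i \<ge> s}"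
    using assms by (auto simp: abs_coord_nth)
  moreover have "j \<notin> {i. w $ i \<ge> s}" using assms by auto
  ultimately have p: "N_plus (abs_coord j w) s = Suc (N_plus w s)"
    by (simp add: N_plus_def)
  have "{i. w $ i \<le> - s} = insert j {i. abs_coord j w $ i \<le> - s}"
    using assms by (auto simp: abs_coord_nth)
  moreover have "j \<notin> {i. abs_coord j w $ i \<le> - s}" using assms by (auto simp: abs_coord_nth)
  ultimately have n: "N_minus w s = Suc (N_minus (abs_coord j w) s)"
    by (simp add: N_minus_def)
  \<comment> \<open>The offset \<open>1\<close> in the knockoff+ ratio makes up for \<open>j\<close>
    having left the negative count, so the numerator is \<open>N_minus w s\<close>. The maximum with
    \<open>1\<close> disappears because \<open>j\<close> itself is counted in the
    denominator.\<close>
  show ?thesis unfolding knockoff_plus_feasible_def mem_Collect_eq c p n by simp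
qed

text \<open>If one threshold \<open>s\<close> were strictly smaller, both coordinates would be at
  most \<open>- s\<close>. Feasibility of \<open>s\<close> is then the same condition for both
  modified vectors, so the larger threshold would not be minimal.\<close>

lemma threshold_abs_coord_eq:
  fixes w :: "real^'m"
  assumes j: "w $ j < 0" "knockoff_plus_threshold q (abs_coord j w) \<le> ereal (- w $ j)"
    and k: "w $ k < 0" "knockoff_plus_threshold q (abs_coord k w) \<le> ereal (- w $ k)"
  shows "knockoff_plus_threshold q (abs_coord j w) = knockoff_plus_threshold q (abs_coord k w)"
proof -
  have le: "knockoff_plus_threshold q (abs_coord j w) \<le> knockoff_plus_threshold q (abs_coord k w)"
    if j: "w $ j < 0" "knockoff_plus_threshold q (abs_coord j w) \<le> ereal (- w $ j)"
      and k: "w $ k < 0" "knockoff_plus_threshold q (abs_coord k w) \<le> ereal (- w $ k)" for j k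
  proof (rule ccontr)
    assume *: "\<not> ?thesis"
    define F where "F = knockoff_plus_feasible q (abs_coord k w)"
    define s where "s = Min F"
    have "F \<noteq> {}" using k by (auto simp: threshold_le_iff F_def)
    then have sF: "s \<in> F" using Min_in[OF finite_feasible] by (simp add: s_def F_def)
    have thr: "knockoff_plus_threshold q (abs_coord k w) = ereal s"
      using \<open>F \<noteq> {}\<close> by (simp add: knockoff_plus_threshold_def F_def s_def)
    have "0 < s" using sF by (auto simp: F_def knockoff_plus_feasible_def candidates_def)
    have wk: "w $ k \<le> - s" using k by (simp add: thr)
    have "ereal s \<le> ereal (- w $ j)"
      using * j unfolding thr by (meson linear order_trans)
    then have wj: "w $ j \<le> - s" by simp
    have "s \<in> knockoff_plus_feasible q (abs_coord j w)"
      using sF unfolding F_def feasible_abs_coord_iff[OF \<open>0 < s\<close> wk]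
        feasible_abs_coord_iff[OF \<open>0 < s\<close> wj] .
    then have "knockoff_plus_threshold q (abs_coord j w) \<le> ereal s"
      using threshold_le_iff by blast
    then show False using * thr by simp
  qed
  show ?thesis using le[OF j k] le[OF k j] by (rule antisym)
qed

text \<open>Only indices in \<open>J\<close> contribute. They share one threshold, so for
  \<open>j\<close> in \<open>J\<close> every other member of \<open>J\<close> is counted in the
  denominator of its weight, which is then at least \<open>card J\<close>.\<close>

lemma sum_null_weight_abs_coord_le_1:
  fixes w :: "real^'m"
  shows "(\<Sum>j | w $ j < 0. null_weight q j (abs_coord j w)) \<le> 1"
proof -
  define J where "J = {j. w $ j < 0 \<and> knockoff_plus_threshold q (abs_coord j w) \<le> ereal (- w $ j)}"
  have fin: "finite J" by simp
  have eq: "(\<Sum>j | w $ j < 0. null_weight q j (abs_coord j w)) = (\<Sum>j\<in>J. null_weight q j (abs_coord j w))"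
    by (rule sum.mono_neutral_right) (auto simp: J_def null_weight_def abs_coord_nth)
  have "null_weight q j (abs_coord j w) \<le> 1 / real (card J)" if j: "j \<in> J" for j
  proof -
    let ?T = "knockoff_plus_threshold q (abs_coord j w)"
    have "J - {j} \<subseteq> {k. ?T \<le> ereal (- abs_coord j w $ k)}"
    proof
      fix k assume k: "k \<in> J - {j}"
      then have "?T = knockoff_plus_threshold q (abs_coord k w)"
        using j by (intro threshold_abs_coord_eq) (auto simp: J_def)
      then show "k \<in> {k. ?T \<le> ereal (- abs_coord j w $ k)}"
        using k by (auto simp: J_def abs_coord_nth)
    qed
    then have "card (J - {j}) \<le> card {k. ?T \<le> ereal (- abs_coord j w $ k)}"
      by (intro card_mono) auto
    moreover have "card J = Suc (card (J - {j}))"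
      using j by (intro card.remove) auto
    ultimately have "real (card J) \<le> 1 + real (card {k. ?T \<le> ereal (- abs_coord j w $ k)})"
      by linarith
    moreover have "card J > 0" using j fin by (auto simp: card_gt_0_iff)
    ultimately show ?thesis
      unfolding null_weight_def by (intro frac_le) auto
  qed
  then have "(\<Sum>j\<in>J. null_weight q j (abs_coord j w)) \<le> real (card J) * (1 / real (card J))"
    by (rule sum_bounded_above)
  \<comment> \<open>The product is \<open>1\<close>, or \<open>0\<close> when \<open>J\<close> is
    empty.\<close>
  also have "\<dots> \<le> 1" by simp
  finally show ?thesis by (simp add: eq)
qed

section \<open>Measurability of thresholds, weights and coordinate maps\<close>

lemma real_card_Collect: "real (card {i::'m::finite. P i}) = (\<Sum>i\<in>UNIV. of_bool (P i))"
  by (simp add: of_bool_def sum.If_cases)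

text \<open>Feasible thresholds are absolute values of coordinates, so the event is a finite
  disjunction of comparisons, with counts written as sums of indicators. The factor \<open>c\<close>
  treats both signs of the coordinate at once.\<close>

lemma threshold_le_measurable:
  "Measurable.pred borel (\<lambda>w::real^'m. knockoff_plus_threshold q w \<le> ereal (c * w $ j))"
proof -
  have "knockoff_plus_threshold q w \<le> ereal (c * w $ j) \<longleftrightarrow>
    (\<exists>i. \<bar>w $ i\<bar> > 0 \<and> \<bar>w $ i\<bar> \<le> c * w $ j \<and>
       (1 + (\<Sum>k\<in>UNIV. of_bool (w $ k \<le> - \<bar>w $ i\<bar>)))
         / max (\<Sum>k\<in>UNIV. of_bool (\<bar>w $ i\<bar> \<le> w $ k)) 1 \<le> q)" for w :: "real^'m"
    unfolding threshold_le_iff knockoff_plus_feasible_def candidates_def N_plus_def N_minus_def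
      of_nat_max real_card_Collect by auto
  then show ?thesis by (simp only:) measurable
qed

lemma [measurable]:
  shows threshold_le_pos_measurable:
    "Measurable.pred borel (\<lambda>w::real^'m. knockoff_plus_threshold q w \<le> ereal (w $ j))"
  and threshold_le_neg_measurable:
    "Measurable.pred borel (\<lambda>w::real^'m. knockoff_plus_threshold q w \<le> ereal (- w $ j))"
  using threshold_le_measurable[of q 1 j] threshold_le_measurable[of q "-1" j] by simp_all

lemma null_weight_measurable [measurable]: "null_weight q j \<in> borel_measurable borel"
  unfolding null_weight_def real_card_Collect by measurable

lemma abs_coord_measurable [measurable]: "abs_coord j \<in> borel_measurable borel"
proof -
  have "abs_coord j w = w + (\<bar>w $ j\<bar> - w $ j) *\<^sub>R axis j 1" for w
    by (auto simp: vec_eq_iff abs_coord_nth axis_def)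
  then have "abs_coord j = (\<lambda>w. w + (\<bar>w $ j\<bar> - w $ j) *\<^sub>R axis j 1)" by auto
  then show ?thesis by simp
qed

lemma reflect_eq: "reflect j x = x - (2 * x $ j) *\<^sub>R axis j 1"
  by (auto simp: vec_eq_iff reflect_nth axis_def)

lemma reflect_measurable [measurable]: "reflect j \<in> borel_measurable borel"
  unfolding reflect_eq[abs_def] by measurable

section \<open>Changes of variables for Lebesgue measure and the normal law\<close>

text \<open>The reflection is diagonal in the standard basis with entries \<open>1\<close> and
  \<open>-1\<close>, so its Jacobian factor is \<open>1\<close>.\<close>

lemma distr_lborel_reflect: "distr lborel borel (reflect j) = (lborel :: (real^'m) measure)"
proof -
  define e :: "real^'m" where "e = axis j 1"
  have e: "e \<in> Basis" by (simp add: e_def axis_in_Basis_iff)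
  define c :: "real^'m \<Rightarrow> real" where "c b = (if b = e then -1 else 1)" for b
  have T: "0 + (\<Sum>b\<in>Basis. (c b * (x \<bullet> b)) *\<^sub>R b) = reflect j x" for x
  proof -
    have "(\<Sum>b\<in>Basis. (c b * (x \<bullet> b)) *\<^sub>R b)
        = (\<Sum>b\<in>Basis. (x \<bullet> b) *\<^sub>R b - (if b = e then (2 * (x \<bullet> e)) *\<^sub>R e else 0))"
      by (rule sum.cong) (auto simp: c_def scaleR_left_distrib[symmetric] simp flip: scaleR_minus_left scaleR_left_diff_distrib)
    also have "\<dots> = x - (2 * (x \<bullet> e)) *\<^sub>R e"
      using e by (simp add: sum_subtractf euclidean_representation)
    finally show ?thesis by (simp add: reflect_eq e_def inner_axis)
  qed
  have "lborel = density (distr lborel borel (\<lambda>x. 0 + (\<Sum>b\<in>Basis. (c b * (x \<bullet> b)) *\<^sub>R b)))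
      (\<lambda>_. (\<Prod>b\<in>Basis. \<bar>c b\<bar>))"
    by (rule lborel_affine_euclidean) (simp add: c_def)
  moreover have "(\<Prod>b\<in>Basis. \<bar>c b\<bar>) = 1" by (rule prod.neutral) (simp add: c_def)
  ultimately show ?thesis unfolding T by (simp add: density_1)
qed

lemma distr_lborel_uminus: "distr lborel borel uminus = (lborel :: 'a::euclidean_space measure)"
  using lborel_affine[of "-1" "0::'a"] by (simp add: density_1)

lemma mvn_density_measurable [measurable]: "mvn_density \<mu> S \<in> borel_measurable borel"
proof -
  have "continuous_on UNIV (\<lambda>x. matrix_inv S *v (x - \<mu>))"
    by (rule linear_continuous_on_compose[where g="(*v) (matrix_inv S)", unfolded o_def])
       (auto intro!: continuous_intros simp: matrix_vector_mul_linear)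
  then have [measurable]: "(\<lambda>x. matrix_inv S *v (x - \<mu>)) \<in> borel_measurable borel"
    by (rule borel_measurable_continuous_onI)
  show ?thesis unfolding mvn_density_def[abs_def] by measurable
qed

lemma mvn_distributed_imp_mvn:
  assumes "mvn_distributed M X \<mu> S"
  shows "distr M borel X = mvn \<mu> S"
  using distributed_distr_eq_density[of M lborel X] assms
  by (simp add: mvn_distributed_def mvn_def cong: distr_cong)

lemma mvn_distributed_measurable:
  assumes "mvn_distributed M X \<mu> S"
  shows "X \<in> borel_measurable M"
  using assms distributed_measurable[of M lborel X] by (simp add: mvn_distributed_def)

lemma sets_mvn [simp, measurable_cong]: "sets (mvn \<mu> S) = sets borel"
  by (simp add: mvn_def)

lemma space_mvn [simp]: "space (mvn \<mu> S) = UNIV"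
  by (simp add: mvn_def)

lemma nn_integral_mvn:
  assumes [measurable]: "g \<in> borel_measurable borel"
  shows "(\<integral>\<^sup>+x. g x \<partial>mvn \<mu> S) = (\<integral>\<^sup>+x. ennreal (mvn_density \<mu> S x) * g x \<partial>lborel)"
  unfolding mvn_def by (rule nn_integral_density) auto

text \<open>Translation invariance of Lebesgue measure; this reduces an arbitrary mean to the
  centred law.\<close>

lemma nn_integral_mvn_shift:
  assumes [measurable]: "g \<in> borel_measurable borel"
  shows "(\<integral>\<^sup>+x. g x \<partial>mvn \<mu> S) = (\<integral>\<^sup>+x. g (\<mu> + x) \<partial>mvn 0 S)"
proof -
  have "(\<integral>\<^sup>+x. g x \<partial>mvn \<mu> S)
      = (\<integral>\<^sup>+x. ennreal (mvn_density \<mu> S x) * g x \<partial>distr lborel borel ((+) \<mu>))"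
    by (simp add: nn_integral_mvn lborel_distr_plus)
  also have "\<dots> = (\<integral>\<^sup>+x. ennreal (mvn_density 0 S x) * g (\<mu> + x) \<partial>lborel)"
    by (subst nn_integral_distr) (measurable, simp add: mvn_density_def)
  finally show ?thesis by (simp add: nn_integral_mvn)
qed

lemma nn_integral_mvn_uminus:
  assumes [measurable]: "g \<in> borel_measurable borel"
  shows "(\<integral>\<^sup>+x. g (- x) \<partial>mvn 0 S) = (\<integral>\<^sup>+x. g x \<partial>mvn 0 S)"
proof -
  have "mvn_density 0 S (- x) = mvn_density 0 S x" for x
    by (simp add: mvn_density_def linear_neg[OF matrix_vector_mul_linear])
  then have "(\<integral>\<^sup>+x. g (- x) \<partial>mvn 0 S)
      = (\<integral>\<^sup>+x. ennreal (mvn_density 0 S (- x)) * g (- x) \<partial>lborel)"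
    by (simp add: nn_integral_mvn)
  also have "\<dots> = (\<integral>\<^sup>+x. ennreal (mvn_density 0 S x) * g x \<partial>distr lborel borel uminus)"
    by (subst nn_integral_distr) simp_all
  finally show ?thesis by (simp add: nn_integral_mvn distr_lborel_uminus)
qed

text \<open>Reflection exchanges the two open half-spaces and preserves Lebesgue measure, so only
  the density ratio remains. For \<open>g = 1\<close> the right-hand side is the mean of
  \<open>exp (ell S j x)\<close> over \<open>x $ j < 0\<close>.\<close>

lemma nn_integral_mvn_reflect:
  fixes S :: "real^'m^'m"
  assumes "positive_definite S" "S $ j $ j = 1" and [measurable]: "g \<in> borel_measurable borel"
  shows "(\<integral>\<^sup>+x. g x * indicator {x. 0 < x $ j} x \<partial>mvn 0 S)
       = (\<integral>\<^sup>+x. g (reflect j x) * ennreal (exp (ell S j x)) * indicator {x. x $ j < 0} x \<partial>mvn 0 S)"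
proof -
  have "(\<integral>\<^sup>+x. g x * indicator {x. 0 < x $ j} x \<partial>mvn 0 S)
      = (\<integral>\<^sup>+x. ennreal (mvn_density 0 S x) * (g x * indicator {x. 0 < x $ j} x)
          \<partial>distr lborel borel (reflect j))"
    by (simp add: nn_integral_mvn distr_lborel_reflect)
  also have "\<dots> = (\<integral>\<^sup>+x. ennreal (mvn_density 0 S (reflect j x)) *
      (g (reflect j x) * indicator {x. 0 < x $ j} (reflect j x)) \<partial>lborel)"
    by (rule nn_integral_distr) measurable
  also have "\<dots> = (\<integral>\<^sup>+x. ennreal (mvn_density 0 S x) *
      (g (reflect j x) * ennreal (exp (ell S j x)) * indicator {x. x $ j < 0} x) \<partial>lborel)"
    by (rule nn_integral_cong)
      (auto simp: indicator_def reflect_nth mvn_density_reflect assms ennreal_mult'' mult_ac)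
  finally show ?thesis by (subst nn_integral_mvn) simp_all
qed

text \<open>The two open half-spaces are disjoint and have equal mass by symmetry. An inequality
  suffices, so the mass of the hyperplane between them is left open.\<close>

lemma emeasure_mvn_pos_le_half:
  assumes "prob_space (mvn 0 S)"
  shows "emeasure (mvn 0 S) {x. 0 < x $ j} \<le> ennreal (1 / 2)"
proof -
  interpret prob_space "mvn 0 S" by fact
  have "emeasure (mvn 0 S) {x. 0 < x $ j} = (\<integral>\<^sup>+x. indicator {x. 0 < x $ j} (- x) \<partial>mvn 0 S)"
    by (simp add: nn_integral_mvn_uminus[of "indicator {x. 0 < x $ j}"])
  also have "\<dots> = (\<integral>\<^sup>+x. indicator {x. x $ j < 0} x \<partial>mvn 0 S)"
    by (rule nn_integral_cong) (auto simp: indicator_def)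
  finally have eq: "emeasure (mvn 0 S) {x. 0 < x $ j} = emeasure (mvn 0 S) {x. x $ j < 0}"
    by simp
  have "prob {x. 0 < x $ j} + prob {x. x $ j < 0} = prob ({x. 0 < x $ j} \<union> {x. x $ j < 0})"
    by (rule finite_measure_Union[symmetric]) auto
  also have "\<dots> \<le> 1" by (rule prob_le_1)
  finally have "prob {x. 0 < x $ j} \<le> 1 / 2"
    using eq by (simp add: emeasure_eq_measure)
  then show ?thesis unfolding emeasure_eq_measure by (rule ennreal_leI)
qed

section \<open>The reflection argument for the expected sum of null weights\<close>

text \<open>Serves both FDR bounds: \<open>u\<close> is the constant \<open>1\<close> for the bound
  by \<open>Omega_minus\<close> and a cutoff at \<open>\<kappa>\<close> for the tail bound. The
  factor \<open>u\<close> sees \<open>x\<close> only through \<open>ell S j x\<close>, which the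
  reflection preserves.\<close>

lemma nn_integral_sum_null_weight_le:
  fixes S :: "real^'m^'m" and u :: "real \<Rightarrow> ennreal"
  assumes pd: "positive_definite S" and diag: "\<And>j. S $ j $ j = 1"
    and [measurable]: "u \<in> borel_measurable borel"
    and bound: "\<And>j x. x $ j < 0 \<Longrightarrow> u (ell S j x) * ennreal (exp (ell S j x)) \<le> B x"
  shows "(\<integral>\<^sup>+x. (\<Sum>j\<in>null_set \<mu>. ennreal (null_weight q j (\<mu> + x)) * u (ell S j x)) \<partial>mvn 0 S)
       \<le> (\<integral>\<^sup>+x. B x \<partial>mvn 0 S)"
proof -
  let ?G = "\<lambda>j x. ennreal (null_weight q j (abs_coord j (\<mu> + x)))"
  \<comment> \<open>Since \<open>\<mu> $ j = 0\<close>, the weight vanishes unless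
    \<open>x $ j > 0\<close>, and there \<open>abs_coord\<close> changes nothing.\<close>
  have pos: "ennreal (null_weight q j (\<mu> + x)) = ?G j x * indicator {x. 0 < x $ j} x"
    if "j \<in> null_set \<mu>" for j x
    using that by (cases "0 < x $ j") (auto simp: null_set_def abs_coord_eq_self null_weight_eq_0)
  have inv: "abs_coord j (\<mu> + reflect j x) = abs_coord j (\<mu> + x)" if "j \<in> null_set \<mu>" for j x
    using that by (auto simp: vec_eq_iff abs_coord_nth reflect_nth null_set_def)
  have "(\<integral>\<^sup>+x. (\<Sum>j\<in>null_set \<mu>. ennreal (null_weight q j (\<mu> + x)) * u (ell S j x)) \<partial>mvn 0 S)
      = (\<Sum>j\<in>null_set \<mu>. \<integral>\<^sup>+x. (?G j x * u (ell S j x)) * indicator {x. 0 < x $ j} x \<partial>mvn 0 S)"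
    by (subst nn_integral_sum[symmetric])
      (auto intro!: nn_integral_cong sum.cong simp: pos mult_ac)
  also have "\<dots> = (\<Sum>j\<in>null_set \<mu>. \<integral>\<^sup>+x. ?G j x * u (ell S j x) * ennreal (exp (ell S j x))
      * indicator {x. x $ j < 0} x \<partial>mvn 0 S)"
    by (rule sum.cong[OF refl], subst nn_integral_mvn_reflect[OF pd diag])
      (simp_all add: inv ell_reflect)
  also have "\<dots> = (\<integral>\<^sup>+x. (\<Sum>j\<in>null_set \<mu>. ?G j x * u (ell S j x) * ennreal (exp (ell S j x))
      * indicator {x. x $ j < 0} x) \<partial>mvn 0 S)"
    by (rule nn_integral_sum[symmetric]) measurable
  also have "\<dots> \<le> (\<integral>\<^sup>+x. B x \<partial>mvn 0 S)"
  proof (rule nn_integral_mono)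
    fix x
    have "(\<Sum>j\<in>null_set \<mu>. ?G j x * u (ell S j x) * ennreal (exp (ell S j x)) * indicator {x. x $ j < 0} x)
        \<le> (\<Sum>j\<in>null_set \<mu>. ?G j x * indicator {x. x $ j < 0} x * B x)"
    proof (rule sum_mono)
      fix j
      show "?G j x * u (ell S j x) * ennreal (exp (ell S j x)) * indicator {x. x $ j < 0} x
          \<le> ?G j x * indicator {x. x $ j < 0} x * B x"
        using mult_left_mono[OF bound[of x j], of "?G j x"]
        by (cases "x $ j < 0") (simp_all add: mult.assoc)
    qed
    also have "\<dots> = (\<Sum>j\<in>null_set \<mu>. ?G j x * indicator {x. x $ j < 0} x) * B x"
      by (rule sum_distrib_right[symmetric])
    also have "(\<Sum>j\<in>null_set \<mu>. ?G j x * indicator {x. x $ j < 0} x)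
        = ennreal (\<Sum>j | j \<in> null_set \<mu> \<and> (\<mu> + x) $ j < 0. null_weight q j (abs_coord j (\<mu> + x)))"
    proof -
      have "(\<Sum>j\<in>null_set \<mu>. ?G j x * indicator {x. x $ j < 0} x)
          = (\<Sum>j | j \<in> null_set \<mu> \<and> (\<mu> + x) $ j < 0. ?G j x)"
        by (rule sum.mono_neutral_cong_right) (auto simp: null_set_def indicator_def)
      then show ?thesis by (simp add: null_weight_nonneg)
    qed
    \<comment> \<open>Negative nonnull coordinates are added to reach the deterministic bound; their
      weights are nonnegative.\<close>
    also have "\<dots> \<le> ennreal (\<Sum>j | (\<mu> + x) $ j < 0. null_weight q j (abs_coord j (\<mu> + x)))"
      by (intro ennreal_leI sum_mono2) (auto simp: null_weight_nonneg)
    also have "\<dots> \<le> ennreal 1"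
      by (intro ennreal_leI sum_null_weight_abs_coord_le_1)
    finally show "(\<Sum>j\<in>null_set \<mu>. ?G j x * u (ell S j x) * ennreal (exp (ell S j x)) * indicator {x. x $ j < 0} x)
        \<le> B x"
      by (simp add: mult_right_mono)
  qed
  finally show ?thesis .
qed

section \<open>Pointwise bounds on \<open>Omega_minus\<close> and the bound on its mean\<close>

lemma Omega_minus_ge:
  assumes "x $ j < 0"
  shows "exp (ell S j x) \<le> Omega_minus S x"
  unfolding Omega_minus_def exp_le_cancel_iff
  by (rule Max_ge) (use assms in \<open>auto simp: setcompr_eq_image\<close>)

lemma Omega_minus_ge_1: "1 \<le> Omega_minus S x"
  unfolding Omega_minus_def one_le_exp_iff
  by (rule Max_ge) (auto simp: setcompr_eq_image)

text \<open>The maximum is attained, so \<open>Omega_minus\<close> is either \<open>1\<close> or one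
  of the summands.\<close>

lemma Omega_minus_le: "Omega_minus S x \<le> 1 + (\<Sum>j\<in>UNIV. exp (ell S j x) * indicator {x. x $ j < 0} x)"
proof -
  define F where "F = insert 0 {ell S j x | j. x $ j < 0}"
  have "Max F \<in> F" unfolding F_def by (rule Max_in) (auto simp: setcompr_eq_image)
  then consider "Max F = 0" | j where "Max F = ell S j x" "x $ j < 0" by (auto simp: F_def)
  then show ?thesis
  proof cases
    case 1
    then show ?thesis by (simp add: Omega_minus_def F_def sum_nonneg)
  next
    case 2
    have "exp (ell S j x) * indicator {x. x $ j < 0} x
        \<le> (\<Sum>j\<in>UNIV. exp (ell S j x) * indicator {x. x $ j < 0} x)"
      by (rule member_le_sum) auto
    with 2 show ?thesis by (simp add: Omega_minus_def F_def)
  qed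
qed

lemma nn_integral_Omega_minus_le:
  fixes S :: "real^'m^'m"
  assumes pd: "positive_definite S" and diag: "\<And>j. S $ j $ j = 1"
    and prob: "prob_space (mvn 0 S)"
  shows "(\<integral>\<^sup>+x. ennreal (Omega_minus S x) \<partial>mvn 0 S) \<le> ennreal (1 + real CARD('m) / 2)"
proof -
  interpret prob_space "mvn 0 S" by fact
  let ?h = "\<lambda>j x. ennreal (exp (ell S j x)) * indicator {x. x $ j < 0} x"
  have "(\<integral>\<^sup>+x. ennreal (Omega_minus S x) \<partial>mvn 0 S)
      \<le> (\<integral>\<^sup>+x. 1 + (\<Sum>j\<in>UNIV. ?h j x) \<partial>mvn 0 S)"
  proof (rule nn_integral_mono)
    fix x
    have "ennreal (Omega_minus S x)
        \<le> ennreal (1 + (\<Sum>j\<in>UNIV. exp (ell S j x) * indicator {x. x $ j < 0} x))"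
      by (rule ennreal_leI[OF Omega_minus_le])
    also have "\<dots> = 1 + (\<Sum>j\<in>UNIV. ?h j x)"
      by (simp add: ennreal_plus sum_nonneg ennreal_indicator ennreal_mult flip: sum_ennreal)
    finally show "ennreal (Omega_minus S x)
        \<le> 1 + (\<Sum>j\<in>UNIV. ?h j x)" .
  qed
  also have "\<dots> = 1 + (\<Sum>j\<in>UNIV. \<integral>\<^sup>+x. ?h j x \<partial>mvn 0 S)"
  proof (subst nn_integral_add)
    show "(\<integral>\<^sup>+x. 1 \<partial>mvn 0 S) + (\<integral>\<^sup>+x. (\<Sum>j\<in>UNIV. ?h j x) \<partial>mvn 0 S)
        = 1 + (\<Sum>j\<in>UNIV. \<integral>\<^sup>+x. ?h j x \<partial>mvn 0 S)"
      by (subst nn_integral_sum) (simp_all only: nn_integral_const emeasure_space_1 mult_1, measurable)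
  qed measurable
  \<comment> \<open>The reflection identity with \<open>g = 1\<close> turns each exponential moment
    into the probability of the opposite half-space.\<close>
  also have "\<dots> = 1 + (\<Sum>j\<in>UNIV. emeasure (mvn 0 S) {x. 0 < x $ j})"
    using nn_integral_mvn_reflect[OF pd diag, of "\<lambda>_. 1"] by (simp add: nn_integral_indicator)
  also have "\<dots> \<le> 1 + (\<Sum>j\<in>(UNIV :: 'm set). ennreal (1 / 2))"
    by (intro add_left_mono sum_mono emeasure_mvn_pos_le_half prob)
  also have "\<dots> = ennreal (1 + real CARD('m) / 2)"
    by (subst sum_ennreal) (simp_all add: ennreal_plus flip: ennreal_1)
  finally show ?thesis .
qed

section \<open>The two bounds on the false discovery rate and their combination\<close>

lemma rejections_FDP_measurable [measurable]:
  "(\<lambda>w. real (card (rejections q w \<inter> H)) / real (max (card (rejections q w)) 1)) \<in> borel_measurable borel"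
proof -
  have eq: "rejections q w \<inter> H = {i. knockoff_plus_threshold q w \<le> ereal (w $ i) \<and> i \<in> H}" for w H
    by (auto simp: rejections_def)
  have int [simp]: "(\<lambda>w. real (card (rejections q w \<inter> H))) \<in> borel_measurable borel" for H
    unfolding eq real_card_Collect by measurable
  from int[of UNIV] have [simp]: "(\<lambda>w. real (card (rejections q w))) \<in> borel_measurable borel"
    by simp
  show ?thesis
    unfolding of_nat_max by (intro borel_measurable_divide borel_measurable_max) simp_all
qed

text \<open>The proportion is measurable with values in \<open>[0, 1]\<close>, so the Bochner
  integral in \<open>FDR\<close> is a genuine expectation and agrees with the nonnegative integral
  under the centred law.\<close>

lemma ennreal_FDR:
  assumes "prob_space M" "mvn_distributed M W \<mu> S"
  shows "ennreal (FDR M W H q) = (\<integral>\<^sup>+x. ennreal (real (card (rejections q (\<mu> + x) \<inter> H))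
           / real (max (card (rejections q (\<mu> + x))) 1)) \<partial>mvn 0 S)"
proof -
  interpret prob_space M by fact
  have [measurable]: "W \<in> borel_measurable M" by (rule mvn_distributed_measurable) fact
  define f where "f w = real (card (rejections q w \<inter> H)) / real (max (card (rejections q w)) 1)" for w
  have [measurable]: "f \<in> borel_measurable borel" unfolding f_def by measurable
  have f0: "0 \<le> f w" for w by (simp add: f_def)
  have "f w \<le> 1" for w
  proof -
    have "card (rejections q w \<inter> H) \<le> card (rejections q w)" by (intro card_mono) auto
    then show ?thesis by (simp add: f_def)
  qed
  then have "integrable M (\<lambda>\<omega>. f (W \<omega>))"
    by (intro integrable_const_bound[where B=1]) (auto simp: f0)
  then have "ennreal (FDR M W H q) = (\<integral>\<^sup>+\<omega>. ennreal (f (W \<omega>)) \<partial>M)"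
    unfolding FDR_def f_def[symmetric] by (intro nn_integral_eq_integral[symmetric]) (auto simp: f0)
  also have "\<dots> = (\<integral>\<^sup>+x. ennreal (f x) \<partial>distr M borel W)"
    by (rule nn_integral_distr[symmetric]) measurable
  also have "\<dots> = (\<integral>\<^sup>+x. ennreal (f (\<mu> + x)) \<partial>mvn 0 S)"
    unfolding mvn_distributed_imp_mvn[OF assms(2)] by (rule nn_integral_mvn_shift) measurable
  finally show ?thesis by (simp add: f_def)
qed

lemma FDR_le_Omega_minus:
  fixes S :: "real^'m^'m"
  assumes pd: "positive_definite S" and diag: "\<And>j. S $ j $ j = 1"
    and M: "prob_space M" "mvn_distributed M W \<mu> S" and q: "0 < q"
  shows "ennreal (FDR M W (null_set \<mu>) q) \<le> ennreal q * (\<integral>\<^sup>+x. ennreal (Omega_minus S x) \<partial>mvn 0 S)"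
proof -
  have "ennreal (FDR M W (null_set \<mu>) q)
      \<le> (\<integral>\<^sup>+x. ennreal q * (\<Sum>j\<in>null_set \<mu>. ennreal (null_weight q j (\<mu> + x)) * 1) \<partial>mvn 0 S)"
    unfolding ennreal_FDR[OF M]
    by (intro nn_integral_mono)
      (use ennreal_leI[OF FDP_le_sum_null_weight[OF q]] q in
        \<open>simp add: ennreal_mult sum_nonneg null_weight_nonneg\<close>)
  also have "\<dots> = ennreal q * (\<integral>\<^sup>+x. (\<Sum>j\<in>null_set \<mu>. ennreal (null_weight q j (\<mu> + x)) * 1) \<partial>mvn 0 S)"
    by (rule nn_integral_cmult) measurable
  also have "\<dots> \<le> ennreal q * (\<integral>\<^sup>+x. ennreal (Omega_minus S x) \<partial>mvn 0 S)"
    by (intro mult_left_mono nn_integral_sum_null_weight_le[OF pd diag, where u="\<lambda>_. 1"])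
      (auto intro!: ennreal_leI Omega_minus_ge)
  finally show ?thesis .
qed

text \<open>On the tail event the proportion is bounded by \<open>1\<close>; elsewhere every
  \<open>ell S j x\<close> is at most \<open>\<kappa>\<close> and the truncation is invisible. Each
  summand is truncated by its own \<open>ell S j\<close>, since \<open>L_stat\<close> as a whole
  need not be invariant under reflection of coordinate \<open>j\<close>.\<close>

lemma FDR_le_tail:
  fixes S :: "real^'m^'m"
  assumes pd: "positive_definite S" and diag: "\<And>j. S $ j $ j = 1"
    and prob: "prob_space (mvn 0 S)"
    and M: "prob_space M" "mvn_distributed M W \<mu> S" and q: "0 < q"
  shows "ennreal (FDR M W (null_set \<mu>) q)
    \<le> ennreal (exp \<kappa> * q) + emeasure (mvn 0 S) {x. L_stat S x > \<kappa>}"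
proof -
  interpret prob_space "mvn 0 S" by fact
  let ?u = "indicator {..\<kappa>} :: real \<Rightarrow> ennreal"
  let ?A = "{x. L_stat S x > \<kappa>}"
  let ?V = "\<lambda>x. \<Sum>j\<in>null_set \<mu>. ennreal (null_weight q j (\<mu> + x)) * ?u (ell S j x)"
  have "(\<integral>\<^sup>+x. ?V x \<partial>mvn 0 S) \<le> (\<integral>\<^sup>+x. ennreal (exp \<kappa>) \<partial>mvn 0 S)"
    by (rule nn_integral_sum_null_weight_le[OF pd diag])
      (auto simp: indicator_def intro!: ennreal_leI)
  also have "\<dots> = ennreal (exp \<kappa>)" by (simp add: emeasure_space_1[simplified])
  finally have V: "(\<integral>\<^sup>+x. ?V x \<partial>mvn 0 S) \<le> ennreal (exp \<kappa>)" .
  have "ennreal (FDR M W (null_set \<mu>) q)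
      \<le> (\<integral>\<^sup>+x. ennreal q * ?V x + indicator ?A x \<partial>mvn 0 S)"
    unfolding ennreal_FDR[OF M]
  proof (rule nn_integral_mono)
    fix x
    let ?R = "rejections q (\<mu> + x)"
    let ?f = "real (card (?R \<inter> null_set \<mu>)) / real (max (card ?R) 1)"
    show "ennreal ?f \<le> ennreal q * ?V x + indicator ?A x"
    proof (cases "x \<in> ?A")
      case True
      have "card (?R \<inter> null_set \<mu>) \<le> card ?R" by (intro card_mono) auto
      then have "ennreal ?f \<le> ennreal 1" by (intro ennreal_leI) simp
      also have "\<dots> \<le> ennreal q * ?V x + indicator ?A x" using True by simp
      finally show ?thesis .
    next
      case False
      have "ell S j x \<le> \<kappa>" for j
      proof -
        have "max (ell S j x) 0 \<le> L_stat S x" unfolding L_stat_def by (rule Max_ge) auto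
        then show ?thesis using False by simp
      qed
      then have "?V x = ennreal (\<Sum>j\<in>null_set \<mu>. null_weight q j (\<mu> + x))"
        by (simp add: null_weight_nonneg)
      then show ?thesis
        using ennreal_leI[OF FDP_le_sum_null_weight[OF q, of "\<mu> + x" "null_set \<mu>"]] q False
        by (simp add: ennreal_mult sum_nonneg null_weight_nonneg)
    qed
  qed
  also have "\<dots> = ennreal q * (\<integral>\<^sup>+x. ?V x \<partial>mvn 0 S) + emeasure (mvn 0 S) ?A"
  proof (subst nn_integral_add)
    have "(\<integral>\<^sup>+x. ennreal q * ?V x \<partial>mvn 0 S) = ennreal q * (\<integral>\<^sup>+x. ?V x \<partial>mvn 0 S)"
      by (rule nn_integral_cmult) measurable
    then show "(\<integral>\<^sup>+x. ennreal q * ?V x \<partial>mvn 0 S) + (\<integral>\<^sup>+x. indicator ?A x \<partial>mvn 0 S)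
        = ennreal q * (\<integral>\<^sup>+x. ?V x \<partial>mvn 0 S) + emeasure (mvn 0 S) ?A"
      by (simp only:) (simp add: nn_integral_indicator)
  qed measurable
  also have "\<dots> \<le> ennreal q * ennreal (exp \<kappa>) + emeasure (mvn 0 S) ?A"
    by (intro add_right_mono mult_left_mono V) simp
  finally show ?thesis using q by (simp add: ennreal_mult mult.commute)
qed

text \<open>\<open>W\<close> and \<open>X\<close> may live on different probability spaces. The last
  two conjuncts express dependence on \<open>S\<close> alone: both laws are images of
  \<open>mvn 0 S\<close>, whatever \<open>N\<close> and \<open>X\<close> are.\<close>

theorem corollary8:
  fixes S :: "real^'m^'m"
    and N :: "'b measure" and X :: "'b \<Rightarrow> real^'m"
    and \<delta> \<kappa> :: real
  assumes m: "CARD('m) \<ge> 2"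
    and pd: "positive_definite S"
    and diag: "\<And>j. S $ j $ j = 1"
    and N: "prob_space N"
    and X: "mvn_distributed N X 0 S"
    and delta: "0 \<le> \<delta>" "\<delta> < 1"
    and kappa: "0 \<le> \<kappa>"
    and tail: "measure N {\<omega> \<in> space N. L_stat S (X \<omega>) > \<kappa>} \<le> \<delta>"
  shows
    "(\<forall>(\<mu> :: real^'m) q (M :: 'a measure) W.
        prob_space M \<longrightarrow> mvn_distributed M W \<mu> S \<longrightarrow> 0 < q \<longrightarrow> q < 1 \<longrightarrow>
        FDR M W (null_set \<mu>) q
          \<le> min (exp \<kappa> * q + \<delta>) ((\<integral>\<omega>. Omega_minus S (X \<omega>) \<partial>N) * q))
     \<and> 1 \<le> (\<integral>\<omega>. Omega_minus S (X \<omega>) \<partial>N)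
     \<and> (\<integral>\<omega>. Omega_minus S (X \<omega>) \<partial>N) \<le> 1 + real CARD('m) / 2
     \<and> distr N borel (\<lambda>\<omega>. L_stat S (X \<omega>)) = distr (mvn 0 S) borel (L_stat S)
     \<and> distr N borel (\<lambda>\<omega>. Omega_minus S (X \<omega>)) = distr (mvn 0 S) borel (Omega_minus S)"
proof -
  interpret N: prob_space N by fact
  have Xm [measurable]: "X \<in> borel_measurable N" by (rule mvn_distributed_measurable) fact
  have mvn: "mvn 0 S = distr N borel X" using mvn_distributed_imp_mvn[OF X] by simp
  \<comment> \<open>Total mass one is inherited from the law of \<open>X\<close>, so no Gaussian
    integral is evaluated.\<close>
  have prob: "prob_space (mvn 0 S)" unfolding mvn by (rule N.prob_space_distr) simp
  define E where "E = (\<integral>\<omega>. Omega_minus S (X \<omega>) \<partial>N)"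
  have Omega_nonneg: "0 \<le> Omega_minus S x" for x
    using Omega_minus_ge_1[of S x] by linarith
  have nn: "(\<integral>\<^sup>+\<omega>. ennreal (Omega_minus S (X \<omega>)) \<partial>N) = (\<integral>\<^sup>+x. ennreal (Omega_minus S x) \<partial>mvn 0 S)"
    unfolding mvn by (rule nn_integral_distr[symmetric]) measurable
  have le: "(\<integral>\<^sup>+x. ennreal (Omega_minus S x) \<partial>mvn 0 S) \<le> ennreal (1 + real CARD('m) / 2)"
    by (rule nn_integral_Omega_minus_le) fact+
  \<comment> \<open>The finite upper bound on the nonnegative integral gives integrability, so
    \<open>E\<close> is not a default value.\<close>
  have int: "integrable N (\<lambda>\<omega>. Omega_minus S (X \<omega>))"
  proof (rule integrableI_nonneg)
    show "(\<integral>\<^sup>+\<omega>. ennreal (Omega_minus S (X \<omega>)) \<partial>N) < \<infinity>"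
      unfolding nn using le by (rule le_less_trans) simp
  qed (simp_all add: Omega_nonneg)
  have E: "(\<integral>\<^sup>+x. ennreal (Omega_minus S x) \<partial>mvn 0 S) = ennreal E"
    unfolding nn[symmetric] E_def using int by (rule nn_integral_eq_integral) (simp add: Omega_nonneg)
  have "1 \<le> E"
    unfolding E_def using N.integral_ge_const[OF int] Omega_minus_ge_1 by blast
  have "E \<le> 1 + real CARD('m) / 2" using le unfolding E by (subst (asm) ennreal_le_iff) auto
  have "emeasure (mvn 0 S) {x. L_stat S x > \<kappa>} = emeasure N {\<omega> \<in> space N. L_stat S (X \<omega>) > \<kappa>}"
    unfolding mvn by (subst emeasure_distr) (auto intro!: arg_cong[where f="emeasure N"])
  then have tail': "emeasure (mvn 0 S) {x. L_stat S x > \<kappa>} \<le> ennreal \<delta>"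
    using tail by (simp add: N.emeasure_eq_measure ennreal_leI)
  have "FDR M W (null_set \<mu>) q \<le> min (exp \<kappa> * q + \<delta>) (E * q)"
    if "prob_space M" "mvn_distributed M W \<mu> S" "0 < q"
    for \<mu> :: "real^'m" and q and M :: "'a measure" and W
  proof (rule min.boundedI)
    have "ennreal (FDR M W (null_set \<mu>) q) \<le> ennreal (exp \<kappa> * q) + ennreal \<delta>"
      using FDR_le_tail[OF pd diag prob that, of \<kappa>] tail' by (meson add_left_mono order_trans)
    also have "\<dots> = ennreal (exp \<kappa> * q + \<delta>)"
      using that delta by (simp add: ennreal_plus)
    finally show "FDR M W (null_set \<mu>) q \<le> exp \<kappa> * q + \<delta>"
      using that delta by (subst (asm) ennreal_le_iff) auto
    have "ennreal (FDR M W (null_set \<mu>) q) \<le> ennreal (E * q)"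
      using FDR_le_Omega_minus[OF pd diag that] \<open>1 \<le> E\<close> that
      unfolding E by (simp add: ennreal_mult mult.commute)
    then show "FDR M W (null_set \<mu>) q \<le> E * q"
      using \<open>1 \<le> E\<close> that by (simp add: ennreal_le_iff)
  qed
  moreover have "distr N borel (\<lambda>\<omega>. L_stat S (X \<omega>)) = distr (mvn 0 S) borel (L_stat S)"
    "distr N borel (\<lambda>\<omega>. Omega_minus S (X \<omega>)) = distr (mvn 0 S) borel (Omega_minus S)"
    unfolding mvn by (simp_all add: distr_distr comp_def)
  ultimately show ?thesis
    using \<open>1 \<le> E\<close> \<open>E \<le> 1 + real CARD('m) / 2\<close> unfolding E_def by blast
qed

end
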